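(* Let $(M,\mathcal{C},\mathcal{C}^* )$ be an orthogonally oriented matroid on $E = X \,\dot\cup\, F \,\dot\cup\, G$ and let $N = M/F\setminus G$, a matroid on $X$. Let $\mathcal{C}_N$ be the set of signed subsets $C|_{\underline{C'}}$, where $\underline{C'}$ ranges over the circuits of $N$ and $C$ ranges over the elements of $\mathcal{C}$ with $\underline{C'} \subseteq \underline{C} \subseteq \underline{C'} \cup F$. Let $\mathcal{C}^*_N$ be the set of signed subsets $U|_{\underline{U'}}$, where $\underline{U'}$ ranges over the cocircuits of $N$ and $U$ ranges over the elements of $\mathcal{C}^*$ with $\underline{U'} \subseteq \underline{U} \subseteq \underline{U'} \cup G$. Then $(N,\mathcal{C}_N,\mathcal{C}^*_N)$ is an orthogonally oriented matroid on $X$; in particular $N$ is orthogonally orientable.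
   Context: Matroids are matroids in the sense of Bruhn, Diestel, Kriesell, Pendavingh and Wollan, on a possibly infinite ground set; cocircuits of $M$ are the circuits of the dual $M^*$, and minors $M/F\setminus G$ are defined as usual. A signed subset $X$ of $E$ is a subset $\underline{X}\subseteq E$ (its support) together with a partition $(X^+,X^-)$ of $\underline{X}$; write $X(e)=1$ if $e\in X^+$ and $X(e)=-1$ if $e\in X^-$. The opposite $-X$ has $(-X)^+=X^-$, $(-X)^-=X^+$. For $A\subseteq E$, the restriction $X|_A$ has $(X|_A)^+=X^+\cap A$, $(X|_A)^-=X^-\cap A$. Two signed subsets $X,Y$ are orthogonal if either $\underline{X}\cap\underline{Y}=\emptyset$ or there are $e,f\in\underline{X}\cap\underline{Y}$ with $X(e)Y(e)=-X(f)Y(f)$. A circuit signature of a matroid $M$ is a set $\mathcal{C}$ of signed subsets consisting of exactly two opposite signed subsets $C,-C$ with support $\underline{C}$ for each circuit $\underline{C}$ of $M$ (and nothing else); a cocircuit signature of $M$ is a circuit signature of $M^*$. A triple $(M,\mathcal{C},\mathcal{C}^* )$, with $\mathcal{C}$ a circuit signature and $\mathcal{C}^*$ a cocircuit signature of $M$, is an orthogonally oriented matroid if every element of $\mathcal{C}$ is orthogonal to every element of $\mathcal{C}^*$; $M$ is then called orthogonally orientable. (In the situation of the claim, $\mathcal{C}_N$ and $\mathcal{C}^*_N$ are known to be a circuit signature and a cocircuit signature of $N$, the induced signatures.) *)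

theory Defs
  imports Main
begin

section \<open>Matroids on possibly infinite ground sets\<close>

datatype 'a indep_system =
  Indep_System (ground: "'a set") (indep_sets: "'a set set")

definition bases :: "'a indep_system \<Rightarrow> 'a set set" where
  "bases M = {B \<in> indep_sets M. \<forall>I \<in> indep_sets M. B \<subseteq> I \<longrightarrow> I = B}"

text \<open>The independence axioms (I1), (I2), (I3), (IM) of Bruhn, Diestel, Kriesell,
  Pendavingh and Wollan, in this order after the condition on the ground set.\<close>

definition matroid :: "'a indep_system \<Rightarrow> bool" where
  "matroid M \<longleftrightarrow>
     indep_sets M \<subseteq> Pow (ground M) \<and>
     {} \<in> indep_sets M \<and>
     (\<forall>I \<in> indep_sets M. \<forall>J. J \<subseteq> I \<longrightarrow> J \<in> indep_sets M) \<and>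
     (\<forall>I \<in> indep_sets M - bases M. \<forall>B \<in> bases M.
        \<exists>x \<in> B - I. insert x I \<in> indep_sets M) \<and>
     (\<forall>I \<in> indep_sets M. \<forall>X. I \<subseteq> X \<and> X \<subseteq> ground M \<longrightarrow>
        (\<exists>J \<in> indep_sets M. I \<subseteq> J \<and> J \<subseteq> X \<and>
           (\<forall>K \<in> indep_sets M. J \<subseteq> K \<and> K \<subseteq> X \<longrightarrow> K = J)))"

definition circuits :: "'a indep_system \<Rightarrow> 'a set set" where
  "circuits M = {C. C \<subseteq> ground M \<and> C \<notin> indep_sets M \<and> (\<forall>D. D \<subset> C \<longrightarrow> D \<in> indep_sets M)}"

text \<open>The bases of the dual are the complements of the bases.\<close>

definition dual :: "'a indep_system \<Rightarrow> 'a indep_system" where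
  "dual M = Indep_System (ground M) {I. \<exists>B \<in> bases M. I \<subseteq> ground M - B}"

definition cocircuits :: "'a indep_system \<Rightarrow> 'a set set" where
  "cocircuits M = circuits (dual M)"

definition deletion :: "'a indep_system \<Rightarrow> 'a set \<Rightarrow> 'a indep_system" where
  "deletion M G = Indep_System (ground M - G) {I \<in> indep_sets M. I \<subseteq> ground M - G}"

definition contraction :: "'a indep_system \<Rightarrow> 'a set \<Rightarrow> 'a indep_system" where
  "contraction M F = dual (deletion (dual M) F)"

section \<open>Signed sets\<close>

typedef 'a signed_set = "{(P :: 'a set, N :: 'a set). P \<inter> N = {}}"
  by auto

setup_lifting type_definition_signed_set

lift_definition pos :: "'a signed_set \<Rightarrow> 'a set" is fst .

lift_definition neg :: "'a signed_set \<Rightarrow> 'a set" is snd .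

definition support :: "'a signed_set \<Rightarrow> 'a set" where
  "support X = pos X \<union> neg X"

text \<open>The value is only meaningful on the support; it is 0 elsewhere.\<close>

definition sign :: "'a signed_set \<Rightarrow> 'a \<Rightarrow> int" where
  "sign X e = (if e \<in> pos X then 1 else if e \<in> neg X then -1 else 0)"

lift_definition opposite :: "'a signed_set \<Rightarrow> 'a signed_set" is
  "\<lambda>(P, N). (N, P)" by auto

lift_definition restriction :: "'a signed_set \<Rightarrow> 'a set \<Rightarrow> 'a signed_set" is
  "\<lambda>(P, N) A. (P \<inter> A, N \<inter> A)" by auto

definition orthogonal :: "'a signed_set \<Rightarrow> 'a signed_set \<Rightarrow> bool" where
  "orthogonal X Y \<longleftrightarrow>
     support X \<inter> support Y = {} \<or>
     (\<exists>e \<in> support X \<inter> support Y. \<exists>f \<in> support X \<inter> support Y.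
        sign X e * sign Y e = - (sign X f * sign Y f))"

section \<open>Orthogonally oriented matroids\<close>

text \<open>Circuits of a matroid are nonempty, so the two opposite signed sets with the same
  circuit as support are distinct.\<close>

definition circuit_signature :: "'a indep_system \<Rightarrow> 'a signed_set set \<Rightarrow> bool" where
  "circuit_signature M \<C> \<longleftrightarrow>
     (\<forall>X \<in> \<C>. support X \<in> circuits M) \<and>
     (\<forall>D \<in> circuits M. \<exists>X. {Y \<in> \<C>. support Y = D} = {X, opposite X})"

definition cocircuit_signature :: "'a indep_system \<Rightarrow> 'a signed_set set \<Rightarrow> bool" where
  "cocircuit_signature M \<D> \<longleftrightarrow> circuit_signature (dual M) \<D>"

definition orthogonally_oriented_matroid ::
    "'a indep_system \<Rightarrow> 'a signed_set set \<Rightarrow> 'a signed_set set \<Rightarrow> bool" where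
  "orthogonally_oriented_matroid M \<C> \<D> \<longleftrightarrow>
     matroid M \<and> circuit_signature M \<C> \<and> cocircuit_signature M \<D> \<and>
     (\<forall>X \<in> \<C>. \<forall>Y \<in> \<D>. orthogonal X Y)"

definition orthogonally_orientable :: "'a indep_system \<Rightarrow> bool" where
  "orthogonally_orientable M \<longleftrightarrow> (\<exists>\<C> \<D>. orthogonally_oriented_matroid M \<C> \<D>)"

lemma pos_neg_disjoint: "pos X \<inter> neg X = {}"
  by transfer auto

lemma signed_set_eqI: "pos X = pos Y \<Longrightarrow> neg X = neg Y \<Longrightarrow> X = Y"
  by transfer auto

lemma opposite_simps [simp]: "pos (opposite X) = neg X" "neg (opposite X) = pos X"
  by (transfer; auto)+

lemma restriction_simps [simp]:
  "pos (restriction X A) = pos X \<inter> A" "neg (restriction X A) = neg X \<inter> A"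
  by (transfer; auto)+

end

theory Submission
  imports Defs
begin

text \<open>Both signatures of the minor are well defined for the same reason. A circuit \<open>D\<close> of \<open>N\<close>
  lifts to a circuit of \<open>M\<close> that only gains elements of \<open>F\<close>, a cocircuit of \<open>N\<close> lifts to a
  cocircuit of \<open>M\<close> that only gains elements of \<open>G\<close>, and since \<open>F\<close> and \<open>G\<close> are disjoint, lifting does
  not change the intersection of a circuit with a cocircuit. This gives orthogonality. Any two
  elements \<open>e, f\<close> of \<open>D\<close> are cut out of \<open>D\<close> by some cocircuit of \<open>N\<close>, and orthogonality to a lift
  of that cocircuit determines the relative sign of \<open>e\<close> and \<open>f\<close> in every lift of \<open>D\<close>. The cocircuit
  signature is handled by the same argument in the dual.\<close>

section \<open>Bases and duality\<close>

lemma matroid_indep_subset_ground: "matroid M \<Longrightarrow> I \<in> indep_sets M \<Longrightarrow> I \<subseteq> ground M"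
  by (auto simp: matroid_def)

lemma matroid_empty_indep: "matroid M \<Longrightarrow> {} \<in> indep_sets M"
  by (simp add: matroid_def)

lemma matroid_indep_subset: "matroid M \<Longrightarrow> I \<in> indep_sets M \<Longrightarrow> J \<subseteq> I \<Longrightarrow> J \<in> indep_sets M"
  by (simp add: matroid_def)

lemma matroid_augment:
  assumes "matroid M" "I \<in> indep_sets M" "I \<notin> bases M" "B \<in> bases M"
  obtains x where "x \<in> B - I" "insert x I \<in> indep_sets M"
  using assms unfolding matroid_def by (meson DiffI)

lemma matroid_maximal:
  assumes "matroid M" "I \<in> indep_sets M" "I \<subseteq> X" "X \<subseteq> ground M"
  obtains J where "J \<in> indep_sets M" "I \<subseteq> J" "J \<subseteq> X"
    "\<forall>K \<in> indep_sets M. J \<subseteq> K \<and> K \<subseteq> X \<longrightarrow> K = J"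
  using assms unfolding matroid_def by meson

lemma bases_indep: "B \<in> bases M \<Longrightarrow> B \<in> indep_sets M"
  unfolding bases_def by blast

lemma bases_maximal: "B \<in> bases M \<Longrightarrow> I \<in> indep_sets M \<Longrightarrow> B \<subseteq> I \<Longrightarrow> I = B"
  unfolding bases_def by blast

lemma bases_subset_ground: "matroid M \<Longrightarrow> B \<in> bases M \<Longrightarrow> B \<subseteq> ground M"
  by (simp add: bases_indep matroid_indep_subset_ground)

lemma proper_subset_not_base: "B \<in> bases M \<Longrightarrow> I \<subset> B \<Longrightarrow> I \<notin> bases M"
  using bases_indep bases_maximal by blast

text \<open>A maximal independent set between \<open>I\<close> and \<open>I \<union> B\<close> is a
  base: otherwise augmentation would add an element of \<open>B\<close> without leaving
  \<open>I \<union> B\<close>. This is how later proofs prescribe a base inside one set and keep it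
  away from another.\<close>

lemma base_between:
  assumes M: "matroid M" and I: "I \<in> indep_sets M" and B: "B \<in> bases M"
  obtains B' where "B' \<in> bases M" "I \<subseteq> B'" "B' \<subseteq> I \<union> B"
proof -
  have "I \<union> B \<subseteq> ground M"
    using M I B bases_subset_ground matroid_indep_subset_ground by blast
  then obtain J where J: "J \<in> indep_sets M" "I \<subseteq> J" "J \<subseteq> I \<union> B"
    "\<forall>K \<in> indep_sets M. J \<subseteq> K \<and> K \<subseteq> I \<union> B \<longrightarrow> K = J"
    using matroid_maximal[OF M I, of "I \<union> B"] by blast
  have "J \<in> bases M"
  proof (rule ccontr)
    assume "J \<notin> bases M"
    then obtain x where x: "x \<in> B - J" "insert x J \<in> indep_sets M"
      using matroid_augment[OF M J(1) _ B] by blast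
    then have "insert x J = J" using J(3,4) by blast
    then show False using x by blast
  qed
  then show thesis using that J by blast
qed

lemma indep_extends_to_base:
  assumes M: "matroid M" and I: "I \<in> indep_sets M"
  obtains B where "B \<in> bases M" "I \<subseteq> B"
proof -
  obtain J where "J \<in> indep_sets M" "I \<subseteq> J" "J \<subseteq> ground M"
    "\<forall>K \<in> indep_sets M. J \<subseteq> K \<and> K \<subseteq> ground M \<longrightarrow> K = J"
    using matroid_maximal[OF M I matroid_indep_subset_ground[OF M I] order_refl] .
  then have "J \<in> bases M" "I \<subseteq> J"
    unfolding bases_def using matroid_indep_subset_ground[OF M] by simp_all
  then show thesis by (rule that)
qed

section \<open>The dual of a matroid\<close>

lemma ground_dual [simp]: "ground (dual M) = ground M"
  by (simp add: dual_def)

lemma indep_dual: "I \<in> indep_sets (dual M) \<longleftrightarrow> (\<exists>B \<in> bases M. I \<subseteq> ground M - B)"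
  by (simp add: dual_def)

lemma indep_dualI: "B \<in> bases M \<Longrightarrow> I \<subseteq> ground M - B \<Longrightarrow> I \<in> indep_sets (dual M)"
  unfolding indep_dual by (rule bexI)

lemma indep_dualE:
  assumes "I \<in> indep_sets (dual M)"
  obtains B where "B \<in> bases M" "I \<subseteq> ground M - B"
  using assms unfolding indep_dual by (rule bexE)

lemma bases_dual:
  assumes M: "matroid M"
  shows "bases (dual M) = (\<lambda>B. ground M - B) ` bases M"
proof (intro equalityI subsetI)
  fix A assume A: "A \<in> bases (dual M)"
  then obtain B where B: "B \<in> bases M" "A \<subseteq> ground M - B"
    using bases_indep indep_dualE by metis
  then have "ground M - B \<in> indep_sets (dual M)" by (auto intro: indep_dualI)
  then have "ground M - B = A" using bases_maximal[OF A] B(2) by blast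
  then show "A \<in> (\<lambda>B. ground M - B) ` bases M" using B by blast
next
  fix A assume "A \<in> (\<lambda>B. ground M - B) ` bases M"
  then obtain B where B: "B \<in> bases M" "A = ground M - B" by blast
  have "I = A" if "I \<in> indep_sets (dual M)" "A \<subseteq> I" for I
  proof -
    obtain B' where B': "B' \<in> bases M" "I \<subseteq> ground M - B'"
      using \<open>I \<in> indep_sets (dual M)\<close> by (rule indep_dualE)
    then have "B' \<subseteq> B" using bases_subset_ground[OF M B'(1)] B \<open>A \<subseteq> I\<close> by blast
    then have "B = B'" using bases_maximal[OF B'(1) bases_indep[OF B(1)]] by blast
    then show ?thesis using B' B \<open>A \<subseteq> I\<close> by blast
  qed
  moreover have "A \<in> indep_sets (dual M)" using B by (simp add: indep_dualI)
  ultimately show "A \<in> bases (dual M)" unfolding bases_def by blast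
qed

text \<open>Maximality outside \<open>X\<close> is transferred to dual maximality inside
  \<open>X\<close>. This supplies the maximality axiom of the dual and the description of
  contractions.\<close>

lemma base_diff_maximal_coindep:
  assumes M: "matroid M" and B: "B \<in> bases M" and X: "X \<subseteq> ground M"
    and max: "\<forall>K \<in> indep_sets M. B - X \<subseteq> K \<and> K \<subseteq> ground M - X \<longrightarrow> K = B - X"
    and K: "K \<in> indep_sets (dual M)" "X - B \<subseteq> K" "K \<subseteq> X"
  shows "K = X - B"
proof (rule ccontr)
  assume "K \<noteq> X - B"
  obtain B2 where B2: "B2 \<in> bases M" "K \<subseteq> ground M - B2"
    using K(1) by (rule indep_dualE)
  \<comment> \<open>If \<open>K\<close> is strictly larger than \<open>X - B\<close>, the part of
    \<open>B2\<close> inside \<open>X\<close> is a proper subset of \<open>B \<inter> X\<close>.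
    Augmenting \<open>?J\<close> from \<open>B2\<close> must then use an element outside
    \<open>X\<close>, which would enlarge \<open>B - X\<close> there.\<close>
  let ?J = "(B - X) \<union> (B2 \<inter> X)"
  have sub: "?J \<subset> B" using \<open>K \<noteq> X - B\<close> K B2(2) by blast
  then have J: "?J \<in> indep_sets M" "?J \<notin> bases M"
    using matroid_indep_subset[OF M bases_indep[OF B]] proper_subset_not_base[OF B] by blast+
  obtain x where x: "x \<in> B2 - ?J" "insert x ?J \<in> indep_sets M"
    using matroid_augment[OF M J B2(1)] .
  have "insert x (B - X) \<in> indep_sets M"
    by (rule matroid_indep_subset[OF M x(2)]) blast
  moreover have "insert x (B - X) \<subseteq> ground M - X"
    using x bases_subset_ground[OF M B] bases_subset_ground[OF M B2(1)] by blast
  ultimately show False using max x(1) by blast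
qed

lemma matroid_dual:
  assumes M: "matroid M"
  shows "matroid (dual M)"
proof -
  have "{} \<in> indep_sets (dual M)"
    using indep_extends_to_base[OF M matroid_empty_indep[OF M]] indep_dualI by (metis empty_subsetI)
  moreover have "\<exists>x \<in> A - I. insert x I \<in> indep_sets (dual M)"
    if I: "I \<in> indep_sets (dual M)" "I \<notin> bases (dual M)" and A: "A \<in> bases (dual M)" for I A
  proof -
    obtain B where B: "B \<in> bases M" "I \<subseteq> ground M - B" using I indep_dualE by metis
    obtain B' where B': "B' \<in> bases M" "A = ground M - B'" using A bases_dual[OF M] by blast
    have "B' - I \<in> indep_sets M"
      using matroid_indep_subset[OF M bases_indep[OF B'(1)]] by blast
    \<comment> \<open>\<open>B1\<close> still avoids \<open>I\<close>. As \<open>I\<close> is not a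
      dual base, some \<open>x\<close> lies outside both \<open>B1\<close> and \<open>I\<close>; it
      is not in \<open>B'\<close> because \<open>B' - I\<close> is contained in \<open>B1\<close>,
      so it belongs to \<open>A\<close>.\<close>
    then obtain B1 where B1: "B1 \<in> bases M" "B' - I \<subseteq> B1" "B1 \<subseteq> (B' - I) \<union> B"
      using base_between[OF M _ B(1)] by blast
    have "ground M - B1 \<noteq> I" using I(2) B1(1) bases_dual[OF M] by blast
    then obtain x where x: "x \<in> ground M" "x \<notin> B1" "x \<notin> I" using B B1 by blast
    then have "insert x I \<in> indep_sets (dual M)"
      using B B1 by (intro indep_dualI[OF B1(1)]) blast
    then show ?thesis using x B1 B' by blast
  qed
  moreover have "\<exists>J \<in> indep_sets (dual M). I \<subseteq> J \<and> J \<subseteq> X \<and>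
      (\<forall>K \<in> indep_sets (dual M). J \<subseteq> K \<and> K \<subseteq> X \<longrightarrow> K = J)"
    if I: "I \<in> indep_sets (dual M)" and X: "I \<subseteq> X" "X \<subseteq> ground M" for I X
  proof -
    obtain B where B: "B \<in> bases M" "I \<subseteq> ground M - B" using I indep_dualE by metis
    \<comment> \<open>\<open>S\<close> is chosen maximal outside \<open>X\<close> and then completed
      from \<open>B\<close>. The resulting \<open>B1\<close> meets the outside of \<open>X\<close>
      exactly in \<open>S\<close> and avoids \<open>I\<close>, so \<open>X - B1\<close> is the
      required maximal set.\<close>
    obtain S where S: "S \<in> indep_sets M" "S \<subseteq> ground M - X"
      "\<forall>K \<in> indep_sets M. S \<subseteq> K \<and> K \<subseteq> ground M - X \<longrightarrow> K = S"
      using matroid_maximal[OF M matroid_empty_indep[OF M] empty_subsetI Diff_subset] by metis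
    obtain B1 where B1: "B1 \<in> bases M" "S \<subseteq> B1" "B1 \<subseteq> S \<union> B"
      using base_between[OF M S(1) B(1)] .
    have "B1 - X = S"
    proof -
      have "B1 - X \<in> indep_sets M"
        by (rule matroid_indep_subset[OF M bases_indep[OF B1(1)]]) blast
      moreover have "S \<subseteq> B1 - X" "B1 - X \<subseteq> ground M - X"
        using S(2) B1(2) bases_subset_ground[OF M B1(1)] by blast+
      ultimately show ?thesis using S(3) by simp
    qed
    then have "K = X - B1" if "K \<in> indep_sets (dual M)" "X - B1 \<subseteq> K" "K \<subseteq> X" for K
      using base_diff_maximal_coindep[OF M B1(1) X(2) _ that] S(3) by blast
    moreover have "X - B1 \<in> indep_sets (dual M)"
      using X by (intro indep_dualI[OF B1(1)]) blast
    moreover have "I \<subseteq> X - B1" using B B1 S X by blast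
    ultimately show ?thesis by blast
  qed
  moreover have "indep_sets (dual M) \<subseteq> Pow (ground (dual M))"
    "\<forall>I \<in> indep_sets (dual M). \<forall>J. J \<subseteq> I \<longrightarrow> J \<in> indep_sets (dual M)"
    by (auto elim!: indep_dualE intro: indep_dualI)
  ultimately show ?thesis
    unfolding matroid_def by simp
qed

lemma dual_dual:
  assumes M: "matroid M"
  shows "dual (dual M) = M"
proof -
  have "I \<in> indep_sets (dual (dual M)) \<longleftrightarrow> I \<in> indep_sets M" for I
  proof
    assume "I \<in> indep_sets (dual (dual M))"
    then obtain B where "B \<in> bases M" "I \<subseteq> ground M - (ground M - B)"
      unfolding indep_dual[of I "dual M"] bases_dual[OF M] by auto
    then show "I \<in> indep_sets M"
      using matroid_indep_subset[OF M bases_indep, of B I] by blast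
  next
    assume "I \<in> indep_sets M"
    then obtain B where "B \<in> bases M" "I \<subseteq> B" using indep_extends_to_base[OF M] by blast
    then show "I \<in> indep_sets (dual (dual M))"
      unfolding indep_dual[of I "dual M"] bases_dual[OF M]
      using bases_subset_ground[OF M] by auto
  qed
  then show ?thesis by (intro indep_system.expand) auto
qed

section \<open>Minors\<close>

lemma ground_deletion [simp]: "ground (deletion M G) = ground M - G"
  by (simp add: deletion_def)

lemma indep_deletion:
  "I \<in> indep_sets (deletion M G) \<longleftrightarrow> I \<in> indep_sets M \<and> I \<subseteq> ground M - G"
  by (simp add: deletion_def)

text \<open>Only augmentation is delicate, since sets maximal within \<open>ground M - G\<close>
  need not be bases of \<open>M\<close>. If it fails, comparing suitable bases of \<open>M\<close>
  produces an independent set that properly extends the maximal set \<open>I'\<close>.\<close>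

lemma matroid_deletion:
  assumes M: "matroid M"
  shows "matroid (deletion M G)"
proof -
  let ?X = "ground M - G"
  have "\<exists>x \<in> I' - I. insert x I \<in> indep_sets (deletion M G)"
    if I: "I \<in> indep_sets (deletion M G)" "I \<notin> bases (deletion M G)"
      and I': "I' \<in> bases (deletion M G)" for I I'
  proof (rule ccontr)
    assume no: "\<not> ?thesis"
    have IM: "I \<in> indep_sets M" "I \<subseteq> ?X" using I by (simp_all add: indep_deletion)
    have I'M: "I' \<in> indep_sets M" "I' \<subseteq> ?X" using bases_indep[OF I'] by (simp_all add: indep_deletion)
    have I'max: "K = I'" if "K \<in> indep_sets M" "I' \<subseteq> K" "K \<subseteq> ?X" for K
      using bases_maximal[OF I'] that indep_deletion by blast
    obtain B' where B': "B' \<in> bases M" "I' \<subseteq> B'" using indep_extends_to_base[OF M I'M(1)] .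
    have B'X: "B' \<inter> ?X = I'"
      using I'max[of "B' \<inter> ?X"] matroid_indep_subset[OF M bases_indep[OF B'(1)]] B'(2) I'M(2)
      by blast
    obtain B where B: "B \<in> bases M" "I \<subseteq> B" "B \<subseteq> I \<union> B'"
      using base_between[OF M IM(1) B'(1)] .
    have disj: "B \<inter> I' \<subseteq> I"
    proof
      fix x assume x: "x \<in> B \<inter> I'"
      then have "insert x I \<in> indep_sets (deletion M G)"
        using matroid_indep_subset[OF M bases_indep[OF B(1)], of "insert x I"] B(2) IM(2) I'M(2)
        by (auto simp: indep_deletion)
      then show "x \<in> I" using no x by blast
    qed
    \<comment> \<open>Outside \<open>?X\<close> the base \<open>B\<close> is contained in
      \<open>B'\<close>; inside, the failed augmentation leaves only \<open>I\<close>.\<close>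
    have BX: "B \<inter> ?X = I" using disj B(2,3) B'X IM(2) by blast
    obtain J where J: "J \<in> indep_sets M" "J \<subseteq> ?X" "I \<subset> J"
      using I indep_deletion unfolding bases_def by blast
    then obtain y where y: "y \<in> J" "y \<notin> I" by blast
    have "insert y I \<in> indep_sets M" using matroid_indep_subset[OF M J(1)] J(3) y by blast
    then obtain B2 where B2: "B2 \<in> bases M" "insert y I \<subseteq> B2" "B2 \<subseteq> insert y I \<union> B"
      using base_between[OF M _ B(1)] by metis
    have "y \<notin> B" using y J(2) BX by blast
    have "\<not> B \<subseteq> B2"
      using bases_maximal[OF B(1) bases_indep[OF B2(1)]] B2(2) \<open>y \<notin> B\<close> by blast
    \<comment> \<open>Gaining \<open>y\<close> forces \<open>B2\<close> to lose some element of
      \<open>B\<close>. It lies outside \<open>?X\<close>, because \<open>B\<close> meets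
      \<open>?X\<close> in \<open>I\<close>, which \<open>B2\<close> contains.\<close>
    then obtain z where z: "z \<in> B" "z \<notin> B2" by blast
    have zX: "z \<notin> ?X" using z BX B2(2) by blast
    \<comment> \<open>\<open>?L\<close> misses \<open>z\<close>, so it is a proper subset of
      \<open>B'\<close> and can be augmented from \<open>B2\<close>. The new element must lie in
      \<open>?X\<close>, because \<open>?L\<close> already contains the rest of \<open>B2\<close>;
      this contradicts the maximality of \<open>I'\<close>.\<close>
    let ?L = "I' \<union> (B2 - ?X)"
    have "?L \<subset> B'"
    proof
      show "?L \<subseteq> B'" using B'(2) B2(3) B(3) IM(2) J(2) y(1) by blast
      have "z \<in> B'" using z(1) zX B(3) IM(2) by blast
      then show "?L \<noteq> B'" using z(2) zX I'M(2) by blast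
    qed
    then have L: "?L \<in> indep_sets M" "?L \<notin> bases M"
      using matroid_indep_subset[OF M bases_indep[OF B'(1)]] proper_subset_not_base[OF B'(1)]
      by blast+
    obtain x where x: "x \<in> B2 - ?L" "insert x ?L \<in> indep_sets M"
      using matroid_augment[OF M L B2(1)] .
    have "insert x I' \<in> indep_sets M" by (rule matroid_indep_subset[OF M x(2)]) blast
    then show False using I'max[of "insert x I'"] x(1) I'M(2) by blast
  qed
  moreover have "\<exists>J \<in> indep_sets (deletion M G). I \<subseteq> J \<and> J \<subseteq> X \<and>
      (\<forall>K \<in> indep_sets (deletion M G). J \<subseteq> K \<and> K \<subseteq> X \<longrightarrow> K = J)"
    if I: "I \<in> indep_sets (deletion M G)" and X: "I \<subseteq> X" "X \<subseteq> ground M - G" for I X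
  proof -
    obtain J where "J \<in> indep_sets M" "I \<subseteq> J" "J \<subseteq> X"
      "\<forall>K \<in> indep_sets M. J \<subseteq> K \<and> K \<subseteq> X \<longrightarrow> K = J"
      using matroid_maximal[OF M, of I X] I X indep_deletion by blast
    then show ?thesis using X indep_deletion by (metis subset_trans)
  qed
  moreover have "indep_sets (deletion M G) \<subseteq> Pow (ground (deletion M G))"
    by (auto simp: indep_deletion)
  moreover have "{} \<in> indep_sets (deletion M G)"
    using matroid_empty_indep[OF M] by (simp add: indep_deletion)
  moreover have "\<forall>I \<in> indep_sets (deletion M G). \<forall>J. J \<subseteq> I \<longrightarrow> J \<in> indep_sets (deletion M G)"
    by (meson indep_deletion matroid_indep_subset[OF M] subset_trans)
  ultimately show ?thesis
    unfolding matroid_def by simp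
qed

section \<open>Contraction\<close>

lemma ground_contraction [simp]: "ground (contraction M F) = ground M - F"
  by (simp add: contraction_def)

lemma matroid_contraction: "matroid M \<Longrightarrow> matroid (contraction M F)"
  by (simp add: contraction_def matroid_dual matroid_deletion)

text \<open>Contraction is defined through the dual; this recovers a test inside \<open>M\<close>,
  with \<open>S\<close> a base of the restriction to \<open>F\<close>.\<close>

lemma indep_contraction:
  assumes M: "matroid M" and F: "F \<subseteq> ground M"
    and S: "S \<in> indep_sets M" "S \<subseteq> F"
      "\<forall>K \<in> indep_sets M. S \<subseteq> K \<and> K \<subseteq> F \<longrightarrow> K = S"
  shows "I \<in> indep_sets (contraction M F) \<longleftrightarrow> I \<subseteq> ground M - F \<and> I \<union> S \<in> indep_sets M"
proof
  let ?X = "ground M - F"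
  assume "I \<in> indep_sets (contraction M F)"
  then obtain A where A: "A \<in> bases (deletion (dual M) F)" "I \<subseteq> ?X - A"
    unfolding contraction_def indep_dual by auto
  then have "A \<in> indep_sets (dual M)" "A \<subseteq> ?X"
    using bases_indep[OF A(1)] by (simp_all add: indep_deletion)
  then obtain B2 where B2: "B2 \<in> bases M" "A \<subseteq> ground M - B2" using indep_dualE by metis
  \<comment> \<open>Completing \<open>S\<close> from \<open>B2\<close> gives a base that avoids
    \<open>A\<close>. Maximality of \<open>A\<close> then makes it the whole complement of
    \<open>B\<close> within \<open>?X\<close>, so \<open>I\<close> lies in \<open>B\<close>.\<close>
  obtain B where B: "B \<in> bases M" "S \<subseteq> B" "B \<subseteq> S \<union> B2" using base_between[OF M S(1) B2(1)] .
  have "?X - B \<in> indep_sets (deletion (dual M) F)"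
    using B(1) by (auto simp: indep_deletion indep_dual)
  then have "?X - B = A"
    using bases_maximal[OF A(1), of "?X - B"] B(3) B2(2) S(2) \<open>A \<subseteq> ?X\<close> by blast
  then have "I \<union> S \<subseteq> B" using A(2) B(2) by blast
  then show "I \<subseteq> ?X \<and> I \<union> S \<in> indep_sets M"
    using A(2) matroid_indep_subset[OF M bases_indep[OF B(1)]] by blast
next
  let ?X = "ground M - F"
  assume I: "I \<subseteq> ?X \<and> I \<union> S \<in> indep_sets M"
  then obtain B where B: "B \<in> bases M" "I \<union> S \<subseteq> B" using indep_extends_to_base[OF M] by blast
  have GX: "ground M - ?X = F" using F by blast
  have "B - ?X = S"
  proof -
    have "B - ?X \<in> indep_sets M"
      by (rule matroid_indep_subset[OF M bases_indep[OF B(1)]]) blast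
    moreover have "S \<subseteq> B - ?X" "B - ?X \<subseteq> F"
      using S(2) B(2) bases_subset_ground[OF M B(1)] by blast+
    ultimately show ?thesis using S(3) by simp
  qed
  then have "K = ?X - B" if "K \<in> indep_sets (dual M)" "?X - B \<subseteq> K" "K \<subseteq> ?X" for K
    using base_diff_maximal_coindep[OF M B(1) Diff_subset _ that] S(3) GX by auto
  moreover have "?X - B \<in> indep_sets (dual M)" by (intro indep_dualI[OF B(1)]) blast
  ultimately have "?X - B \<in> bases (deletion (dual M) F)"
    unfolding bases_def by (auto simp: indep_deletion)
  moreover have "I \<subseteq> ?X - (?X - B)" using I B by blast
  ultimately show "I \<in> indep_sets (contraction M F)"
    unfolding contraction_def indep_dual by auto
qed

section \<open>Circuits and cocircuits\<close>

lemma circuits_dependent: "C \<in> circuits M \<Longrightarrow> C \<notin> indep_sets M"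
  by (simp add: circuits_def)

lemma circuits_subset_ground: "C \<in> circuits M \<Longrightarrow> C \<subseteq> ground M"
  by (simp add: circuits_def)

lemma circuits_minimal: "C \<in> circuits M \<Longrightarrow> D \<subset> C \<Longrightarrow> D \<in> indep_sets M"
  by (simp add: circuits_def)

text \<open>For infinite sets the existence of a circuit in a dependent set is not a matter of choosing
  a minimal one. The fundamental circuit consists of the elements that can be exchanged for \<open>z\<close>.\<close>

lemma fundamental_circuit:
  assumes M: "matroid M" and I: "I \<in> indep_sets M" and z: "z \<in> ground M"
    and dep: "insert z I \<notin> indep_sets M"
  obtains C where "C \<in> circuits M" "z \<in> C" "C \<subseteq> insert z I"
proof -
  define C where "C = {x \<in> insert z I. insert z I - {x} \<in> indep_sets M}"
  \<comment> \<open>Restricting \<open>M\<close> to \<open>insert z I\<close> makes \<open>I\<close>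
    a base, so that augmentation applies to its proper subsets.\<close>
  let ?R = "deletion M (ground M - insert z I)"
  have ground: "insert z I \<subseteq> ground M" using z matroid_indep_subset_ground[OF M I] by blast
  have R: "K \<in> indep_sets ?R \<longleftrightarrow> K \<in> indep_sets M \<and> K \<subseteq> insert z I" for K
    using ground by (auto simp: indep_deletion)
  have MR: "matroid ?R" by (rule matroid_deletion[OF M])
  have "z \<notin> I" using dep I by (metis insert_absorb)
  have zC: "z \<in> C" using I \<open>z \<notin> I\<close> by (simp add: C_def)
  have "K = I" if "K \<in> indep_sets M" "K \<subseteq> insert z I" "I \<subseteq> K" for K
  proof -
    have "K \<noteq> insert z I" using that dep by metis
    then show ?thesis using that by blast
  qed
  then have IR: "I \<in> bases ?R" unfolding bases_def using I R by auto
  have "C \<notin> indep_sets M"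
  proof
    assume "C \<in> indep_sets M"
    then have "C \<in> indep_sets ?R" using R by (auto simp: C_def)
    then obtain J where J: "J \<in> bases ?R" "C \<subseteq> J" using indep_extends_to_base[OF MR] by blast
    have JM: "J \<in> indep_sets M" "J \<subseteq> insert z I" using bases_indep[OF J(1)] R by blast+
    then have "J \<noteq> insert z I" using dep by metis
    then obtain y where y: "y \<in> insert z I" "y \<notin> J" using JM(2) by blast
    have "y \<in> I" using y zC J(2) by blast
    \<comment> \<open>Augmenting \<open>I - {y}\<close> from \<open>J\<close> can only add
      \<open>z\<close>, as \<open>J\<close> omits \<open>y\<close>. Thus \<open>y\<close> is
      exchangeable for \<open>z\<close> and lies in \<open>C\<close>, hence in \<open>J\<close>, a
      contradiction.\<close>
    have "I - {y} \<in> indep_sets ?R" using matroid_indep_subset[OF MR bases_indep[OF IR]] by blast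
    moreover have "I - {y} \<notin> bases ?R" using proper_subset_not_base[OF IR] \<open>y \<in> I\<close> by blast
    ultimately obtain x where x: "x \<in> J - (I - {y})" "insert x (I - {y}) \<in> indep_sets ?R"
      using matroid_augment[OF MR _ _ J(1)] by blast
    have "x = z" using x(1) y(2) JM(2) by blast
    then have "insert z I - {y} \<in> indep_sets M"
      using x(2) R \<open>y \<in> I\<close> \<open>z \<notin> I\<close> by (metis insert_Diff_if singletonD)
    then have "y \<in> C" using y by (simp add: C_def)
    then show False using J(2) y by blast
  qed
  moreover have "D \<in> indep_sets M" if "D \<subset> C" for D
  proof -
    obtain x where "x \<in> C" "x \<notin> D" using \<open>D \<subset> C\<close> by blast
    then have "insert z I - {x} \<in> indep_sets M" "D \<subseteq> insert z I - {x}"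
      using \<open>D \<subset> C\<close> by (auto simp: C_def)
    then show ?thesis by (rule matroid_indep_subset[OF M])
  qed
  moreover have "C \<subseteq> insert z I" by (auto simp: C_def)
  ultimately show thesis using that[of C] zC ground unfolding circuits_def by blast
qed

text \<open>If \<open>x\<close> were the only common element, \<open>C - {x}\<close> could be
  completed to a base from a base avoiding \<open>U - {x}\<close>. The result omits
  \<open>x\<close>, lest it contain \<open>C\<close>, and so avoids all of \<open>U\<close>, making
  \<open>U\<close> independent in the dual.\<close>

lemma circuit_cocircuit_inter_not_singleton:
  assumes M: "matroid M" and C: "C \<in> circuits M" and U: "U \<in> circuits (dual M)"
  shows "C \<inter> U \<noteq> {x}"
proof
  assume x: "C \<inter> U = {x}"
  have "U - {x} \<in> indep_sets (dual M)" using circuits_minimal[OF U] x by blast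
  then obtain B where B: "B \<in> bases M" "U - {x} \<subseteq> ground M - B" by (rule indep_dualE)
  have "C - {x} \<in> indep_sets M" using circuits_minimal[OF C] x by blast
  then obtain B1 where B1: "B1 \<in> bases M" "C - {x} \<subseteq> B1" "B1 \<subseteq> (C - {x}) \<union> B"
    using base_between[OF M _ B(1)] by blast
  have "x \<notin> B1"
  proof
    assume "x \<in> B1"
    then have "C \<subseteq> B1" using B1(2) by blast
    then show False
      using circuits_dependent[OF C] matroid_indep_subset[OF M bases_indep[OF B1(1)]] by blast
  qed
  then have "U \<subseteq> ground M - B1" using circuits_subset_ground[OF U] B1(3) B(2) x by auto
  then show False using circuits_dependent[OF U] indep_dualI[OF B1(1)] by blast
qed

text \<open>Take the fundamental cocircuit of \<open>f\<close> with respect to a base containing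
  \<open>C - {e}\<close>. Within \<open>C\<close> it can contain only \<open>e\<close> and
  \<open>f\<close>, and it cannot meet \<open>C\<close> in \<open>f\<close> alone.\<close>

lemma cocircuit_inter_circuit_pair:
  assumes M: "matroid M" and C: "C \<in> circuits M" and e: "e \<in> C" and f: "f \<in> C" and "e \<noteq> f"
  obtains U where "U \<in> circuits (dual M)" "C \<inter> U = {e, f}"
proof -
  have "C - {e} \<in> indep_sets M" using circuits_minimal[OF C] e by blast
  then obtain B where B: "B \<in> bases M" "C - {e} \<subseteq> B" using indep_extends_to_base[OF M] by blast
  have Bd: "ground M - B \<in> bases (dual M)" using B bases_dual[OF M] by blast
  have "f \<in> B" using B f \<open>e \<noteq> f\<close> by blast
  have fM: "f \<in> ground M" using f circuits_subset_ground[OF C] by blast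
  have "insert f (ground M - B) \<notin> indep_sets (dual M)"
    using bases_maximal[OF Bd, of "insert f (ground M - B)"] \<open>f \<in> B\<close> by blast
  then obtain U where U: "U \<in> circuits (dual M)" "f \<in> U" "U \<subseteq> insert f (ground M - B)"
    using fundamental_circuit[OF matroid_dual[OF M] bases_indep[OF Bd], of f] fM by auto
  have "C \<inter> U \<subseteq> {e, f}" using U(3) B(2) by blast
  moreover have "C \<inter> U \<noteq> {f}" by (rule circuit_cocircuit_inter_not_singleton[OF M C U(1)])
  ultimately have "C \<inter> U = {e, f}" using f U(2) by blast
  then show thesis using that U(1) by blast
qed

section \<open>Lifting circuits from minors\<close>

lemma circuits_deletion: "C \<in> circuits (deletion M G) \<Longrightarrow> C \<in> circuits M"
  unfolding circuits_def by (auto simp: indep_deletion)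

text \<open>Adding a base \<open>S\<close> of \<open>F\<close> to \<open>D\<close> gives a dependent
  set that becomes independent when any element of \<open>D\<close> is removed. Hence a circuit
  inside it must contain all of \<open>D\<close>.\<close>

lemma circuits_contraction_lift:
  assumes M: "matroid M" and F: "F \<subseteq> ground M" and D: "D \<in> circuits (contraction M F)"
  obtains C where "C \<in> circuits M" "D \<subseteq> C" "C \<subseteq> D \<union> F"
proof -
  obtain S where S: "S \<in> indep_sets M" "S \<subseteq> F"
    "\<forall>K \<in> indep_sets M. S \<subseteq> K \<and> K \<subseteq> F \<longrightarrow> K = S"
    using matroid_maximal[OF M matroid_empty_indep[OF M] empty_subsetI F] by metis
  note indep = indep_contraction[OF M F S]
  have DX: "D \<subseteq> ground M - F" using circuits_subset_ground[OF D] by simp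
  have dep: "D \<union> S \<notin> indep_sets M" using circuits_dependent[OF D] DX indep by blast
  have ind: "(D - {x}) \<union> S \<in> indep_sets M" if "x \<in> D" for x
    using circuits_minimal[OF D, of "D - {x}"] that indep by blast
  obtain d where d: "d \<in> D" using dep S(1) by fastforce
  have "insert d ((D - {d}) \<union> S) = D \<union> S" using d by blast
  moreover have "d \<in> ground M" using d DX by blast
  ultimately obtain C where C: "C \<in> circuits M" "C \<subseteq> D \<union> S"
    using fundamental_circuit[OF M ind[OF d], of d] dep by metis
  have "D \<subseteq> C"
  proof
    fix x assume "x \<in> D"
    show "x \<in> C"
    proof (rule ccontr)
      assume "x \<notin> C"
      then have "C \<subseteq> (D - {x}) \<union> S" using C(2) by blast
      then show False
        using circuits_dependent[OF C(1)] matroid_indep_subset[OF M ind[OF \<open>x \<in> D\<close>]] by blast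
    qed
  qed
  then show thesis using that C S(2) by blast
qed

text \<open>Dualising exchanges \<open>F\<close> and \<open>G\<close>, so cocircuits of the minor
  can be lifted as circuits of a minor of the dual.\<close>

lemma dual_minor:
  assumes M: "matroid M"
  shows "dual (deletion (contraction M F) G) = contraction (deletion (dual M) F) G"
  using M by (simp add: contraction_def dual_dual matroid_dual matroid_deletion)

section \<open>Signatures of minors\<close>

lemma support_restriction [simp]: "support (restriction C A) = support C \<inter> A"
  by (auto simp: support_def)

lemma support_opposite [simp]: "support (opposite C) = support C"
  by (auto simp: support_def)

lemma sign_restriction: "e \<in> A \<Longrightarrow> sign (restriction C A) e = sign C e"
  by (simp add: sign_def)

lemma sign_opposite: "sign (opposite C) e = - sign C e"
  using pos_neg_disjoint[of C] by (auto simp: sign_def)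

lemma sign_cases: "e \<in> support C \<Longrightarrow> sign C e = 1 \<or> sign C e = - 1"
  by (auto simp: support_def sign_def)

lemma restriction_eqI_sign:
  assumes "\<And>e. e \<in> A \<Longrightarrow> sign C e = sign D e"
  shows "restriction C A = restriction D A"
proof (rule signed_set_eqI)
  have pos: "e \<in> pos Y \<longleftrightarrow> sign Y e = 1" for Y :: "'a signed_set" and e by (auto simp: sign_def)
  have neg: "e \<in> neg Y \<longleftrightarrow> sign Y e = - 1" for Y :: "'a signed_set" and e
    using pos_neg_disjoint[of Y] by (auto simp: sign_def)
  show "pos (restriction C A) = pos (restriction D A)" using assms pos by auto
  show "neg (restriction C A) = neg (restriction D A)" using assms neg by auto
qed

lemma restriction_opposite: "restriction (opposite C) A = opposite (restriction C A)"
  by (rule signed_set_eqI) auto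

lemma orthogonal_sym: "orthogonal C U \<Longrightarrow> orthogonal U C"
  unfolding orthogonal_def by (simp add: Int_commute mult.commute)

lemma orthogonal_restriction:
  assumes "orthogonal C U" "support C \<inter> support U \<subseteq> A \<inter> B"
  shows "orthogonal (restriction C A) (restriction U B)"
proof (cases "support C \<inter> support U = {}")
  case True
  then show ?thesis by (auto simp: orthogonal_def)
next
  case False
  then obtain e f where "e \<in> support C \<inter> support U" "f \<in> support C \<inter> support U"
    "sign C e * sign U e = - (sign C f * sign U f)"
    using assms(1) unfolding orthogonal_def by blast
  moreover from this have "e \<in> A" "e \<in> B" "f \<in> A" "f \<in> B" using assms(2) by blast+
  ultimately show ?thesis unfolding orthogonal_def
    by (intro disjI2 bexI[where x = e] bexI[where x = f]) (simp_all add: sign_restriction)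
qed

text \<open>The two witnesses of orthogonality cannot coincide, since a product of nonzero signs is
  not its own negative; so they are \<open>e\<close> and \<open>f\<close>. The right-hand side
  depends on \<open>U\<close> only, which makes different choices of \<open>C\<close>
  comparable.\<close>

lemma orthogonal_inter_pair:
  assumes "orthogonal C U" "support C \<inter> support U = {e, f}"
  shows "sign C e * sign C f = - (sign U e * sign U f)"
proof -
  have "e \<in> support C" "e \<in> support U" "f \<in> support C" "f \<in> support U"
    using assms(2) by blast+
  note this[THEN sign_cases]
  moreover have "\<exists>x \<in> {e, f}. \<exists>y \<in> {e, f}. sign C x * sign U x = - (sign C y * sign U y)"
    using assms unfolding orthogonal_def by auto
  ultimately show ?thesis by auto
qed

section \<open>Induced signatures\<close>

lemma circuit_signature_obtain:
  assumes "circuit_signature M \<C>" "D \<in> circuits M"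
  obtains C where "C \<in> \<C>" "opposite C \<in> \<C>" "support C = D"
proof -
  obtain C where "{Y \<in> \<C>. support Y = D} = {C, opposite C}"
    using assms unfolding circuit_signature_def by metis
  then have "C \<in> {Y \<in> \<C>. support Y = D}" "opposite C \<in> {Y \<in> \<C>. support Y = D}" by simp_all
  then show thesis using that[of C] by simp
qed

text \<open>The matroids enter only through the two lifting properties, with \<open>M'\<close> in
  the place of the dual of \<open>M\<close>. The lemma therefore serves circuits and, after
  exchanging \<open>F\<close> with \<open>G\<close> and \<open>\<C>\<close> with
  \<open>\<D>\<close>, cocircuits.\<close>

lemma induced_circuit_signature:
  assumes N: "matroid N" "ground N \<inter> F = {}" "ground N \<inter> G = {}" "F \<inter> G = {}"
    and \<C>: "circuit_signature M \<C>" and \<D>: "circuit_signature M' \<D>"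
    and orth: "\<And>C U. C \<in> \<C> \<Longrightarrow> U \<in> \<D> \<Longrightarrow> orthogonal C U"
    and lift: "\<And>D. D \<in> circuits N \<Longrightarrow> \<exists>C \<in> circuits M. D \<subseteq> C \<and> C \<subseteq> D \<union> F"
    and colift: "\<And>D. D \<in> circuits (dual N) \<Longrightarrow> \<exists>U \<in> circuits M'. D \<subseteq> U \<and> U \<subseteq> D \<union> G"
  shows "circuit_signature N {restriction C C' | C C'.
    C' \<in> circuits N \<and> C \<in> \<C> \<and> C' \<subseteq> support C \<and> support C \<subseteq> C' \<union> F}"
    (is "circuit_signature N ?S")
  unfolding circuit_signature_def
proof (intro conjI ballI)
  fix Y assume "Y \<in> ?S"
  then show "support Y \<in> circuits N" by (auto simp: Int_absorb1)
next
  fix D assume D: "D \<in> circuits N"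
  have DN: "D \<subseteq> ground N" by (rule circuits_subset_ground[OF D])
  obtain K where K: "K \<in> circuits M" "D \<subseteq> K" "K \<subseteq> D \<union> F" using lift[OF D] by blast
  obtain C where C: "C \<in> \<C>" "opposite C \<in> \<C>" "support C = K"
    using circuit_signature_obtain[OF \<C> K(1)] .
  \<comment> \<open>All lifts of \<open>D\<close> have the same relative signs on \<open>D\<close>
    as the reference lift \<open>C\<close>: for distinct \<open>e\<close>, \<open>f\<close> both are
    compared with one lifted cocircuit \<open>U\<close>.\<close>
  have rel: "sign Y e * sign Y f = sign C e * sign C f"
    if Y: "Y \<in> \<C>" "D \<subseteq> support Y" "support Y \<subseteq> D \<union> F" and e: "e \<in> D" and f: "f \<in> D" for Y e f
  proof (cases "e = f")
    case True
    have "e \<in> support Y" "e \<in> support C" using e Y K C by blast+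
    then show ?thesis using True sign_cases[of e Y] sign_cases[of e C] by auto
  next
    case False
    obtain U' where U': "U' \<in> circuits (dual N)" "D \<inter> U' = {e, f}"
      using cocircuit_inter_circuit_pair[OF N(1) D e f False] .
    obtain L where L: "L \<in> circuits M'" "U' \<subseteq> L" "L \<subseteq> U' \<union> G" using colift[OF U'(1)] by blast
    obtain U where U: "U \<in> \<D>" "support U = L" using circuit_signature_obtain[OF \<D> L(1)] by metis
    have U'N: "U' \<subseteq> ground N" using circuits_subset_ground[OF U'(1)] by simp
    \<comment> \<open>The additional elements of \<open>Z\<close> lie in \<open>F\<close> and those
      of \<open>U\<close> in \<open>G\<close>; these sets are disjoint from each other and from the
      ground set of \<open>N\<close>.\<close>
    have "support Z \<inter> support U = {e, f}" if "D \<subseteq> support Z" "support Z \<subseteq> D \<union> F" for Z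
    proof -
      have "support Z \<inter> support U = D \<inter> U'" using that L U(2) U'N DN N(2-4) by blast
      then show ?thesis using U'(2) by simp
    qed
    then show ?thesis
      using orthogonal_inter_pair[OF orth[OF Y(1) U(1)], of e f]
        orthogonal_inter_pair[OF orth[OF C(1) U(1)], of e f] Y(2,3) K(2,3) C(3) by metis
  qed
  have unique: "restriction Y D = restriction C D \<or> restriction Y D = opposite (restriction C D)"
    if Y: "Y \<in> \<C>" "D \<subseteq> support Y" "support Y \<subseteq> D \<union> F" for Y
  proof (cases "\<forall>e \<in> D. sign Y e = sign C e")
    case True
    then show ?thesis using restriction_eqI_sign[of D Y C] by simp
  next
    case False
    then obtain e where e: "e \<in> D" "sign Y e \<noteq> sign C e" by blast
    then have "e \<in> support Y" "e \<in> support C" using Y K C by blast+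
    then have opp: "sign Y e = - sign C e" "sign C e \<noteq> 0"
      using sign_cases[of e Y] sign_cases[of e C] e(2) by auto
    \<comment> \<open>By \<open>rel\<close>, disagreement at the single element \<open>e\<close>
      forces disagreement on all of \<open>D\<close>.\<close>
    have "sign Y f = sign (opposite C) f" if "f \<in> D" for f
    proof -
      have "sign C e * (sign Y f + sign C f) = 0"
        using rel[OF Y e(1) that] opp(1) by (simp add: distrib_left)
      then show ?thesis using opp(2) by (simp add: sign_opposite)
    qed
    then have "restriction Y D = restriction (opposite C) D" by (rule restriction_eqI_sign)
    then show ?thesis by (simp add: restriction_opposite)
  qed
  have "{Y \<in> ?S. support Y = D} = {restriction C D, opposite (restriction C D)}"
  proof (intro equalityI subsetI)
    fix Z assume "Z \<in> {Y \<in> ?S. support Y = D}"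
    then obtain Y C' where Y: "Z = restriction Y C'" "Y \<in> \<C>" "C' \<subseteq> support Y"
      "support Y \<subseteq> C' \<union> F" "support Z = D" by blast
    \<comment> \<open>Since \<open>C'\<close> is contained in the support of \<open>Y\<close>, it is
      itself the support of \<open>Z\<close>.\<close>
    then have "C' = D" by auto
    then show "Z \<in> {restriction C D, opposite (restriction C D)}" using unique Y by blast
  next
    fix Z assume "Z \<in> {restriction C D, opposite (restriction C D)}"
    then have "Z = restriction C D \<or> Z = restriction (opposite C) D"
      by (simp add: restriction_opposite)
    then obtain Y where Y: "Z = restriction Y D" "Y \<in> \<C>" "support Y = K"
      using C by (metis support_opposite)
    then have "support Z = D" using K(2) by auto
    moreover have "Z \<in> ?S" using Y K D by blast
    ultimately show "Z \<in> {Y \<in> ?S. support Y = D}" by blast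
  qed
  then show "\<exists>Z. {Y \<in> ?S. support Y = D} = {Z, opposite Z}" by blast
qed

theorem theorem3p6:
  fixes M N :: "'a indep_system"
    and \<C> \<D> \<C>\<^sub>N \<D>\<^sub>N :: "'a signed_set set"
    and X F G :: "'a set"
  assumes "orthogonally_oriented_matroid M \<C> \<D>"
    and "ground M = X \<union> F \<union> G"
    and "X \<inter> F = {}" and "X \<inter> G = {}" and "F \<inter> G = {}"
    and "N = deletion (contraction M F) G"
    and "\<C>\<^sub>N = {restriction C C' | C C'.
           C' \<in> circuits N \<and> C \<in> \<C> \<and> C' \<subseteq> support C \<and> support C \<subseteq> C' \<union> F}"
    and "\<D>\<^sub>N = {restriction U U' | U U'.
           U' \<in> cocircuits N \<and> U \<in> \<D> \<and> U' \<subseteq> support U \<and> support U \<subseteq> U' \<union> G}"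
  shows "ground N = X \<and> orthogonally_oriented_matroid N \<C>\<^sub>N \<D>\<^sub>N \<and> orthogonally_orientable N"
proof -
  have M: "matroid M" and \<C>: "circuit_signature M \<C>" and \<D>: "circuit_signature (dual M) \<D>"
    and orth: "\<And>C U. C \<in> \<C> \<Longrightarrow> U \<in> \<D> \<Longrightarrow> orthogonal C U"
    using assms(1) unfolding orthogonally_oriented_matroid_def cocircuit_signature_def by blast+
  have ground: "ground N = X" using assms(2-6) by auto
  have N: "matroid N" by (simp add: assms(6) matroid_deletion matroid_contraction M)
  have lift: "\<exists>C \<in> circuits M. D \<subseteq> C \<and> C \<subseteq> D \<union> F" if "D \<in> circuits N" for D
  proof -
    have "F \<subseteq> ground M" using assms(2) by blast
    moreover have "D \<in> circuits (contraction M F)"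
      using that assms(6) circuits_deletion by blast
    ultimately show ?thesis using circuits_contraction_lift[OF M] by metis
  qed
  have colift: "\<exists>U \<in> circuits (dual M). D \<subseteq> U \<and> U \<subseteq> D \<union> G" if "D \<in> circuits (dual N)" for D
  proof -
    have "D \<in> circuits (contraction (deletion (dual M) F) G)"
      using that by (simp add: assms(6) dual_minor[OF M])
    \<comment> \<open>Disjointness of \<open>F\<close> and \<open>G\<close> ensures that all of
      \<open>G\<close> survives the deletion of \<open>F\<close>.\<close>
    moreover have "G \<subseteq> ground (deletion (dual M) F)" using assms(2,5) by auto
    ultimately obtain U where "U \<in> circuits (deletion (dual M) F)" "D \<subseteq> U" "U \<subseteq> D \<union> G"
      using circuits_contraction_lift[OF matroid_deletion[OF matroid_dual[OF M]]] by blast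
    then show ?thesis using circuits_deletion[of U "dual M" F] by blast
  qed
  have "circuit_signature N \<C>\<^sub>N"
    unfolding assms(7)
    by (rule induced_circuit_signature[OF N _ _ assms(5) \<C> \<D> orth lift colift])
      (use ground assms(3,4) in auto)
  \<comment> \<open>The same lemma is applied to the dual of \<open>N\<close> with the roles
    exchanged; its cocircuits are the circuits of \<open>N\<close> by
    \<open>dual_dual\<close>.\<close>
  moreover have "cocircuit_signature N \<D>\<^sub>N"
    unfolding assms(8) cocircuit_signature_def cocircuits_def
    by (rule induced_circuit_signature[where F = G and G = F, OF matroid_dual[OF N] _ _ _ \<D> \<C> _ colift])
      (use ground assms(3-5) orth lift in \<open>simp_all add: dual_dual[OF N] Int_commute orthogonal_sym\<close>)
  moreover have "orthogonal Y Z" if Y: "Y \<in> \<C>\<^sub>N" and Z: "Z \<in> \<D>\<^sub>N" for Y Z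
  proof -
    obtain C C' where C: "Y = restriction C C'" "C' \<in> circuits N" "C \<in> \<C>" "support C \<subseteq> C' \<union> F"
      using Y unfolding assms(7) by blast
    obtain U U' where U: "Z = restriction U U'" "U' \<in> circuits (dual N)" "U \<in> \<D>"
      "support U \<subseteq> U' \<union> G"
      using Z unfolding assms(8) cocircuits_def by blast
    have "C' \<subseteq> X" "U' \<subseteq> X"
      using circuits_subset_ground[OF C(2)] circuits_subset_ground[OF U(2)] ground by auto
    \<comment> \<open>Lifting adds no common elements, so the witnesses of orthogonality in
      \<open>M\<close> survive both restrictions.\<close>
    then have "support C \<inter> support U \<subseteq> C' \<inter> U'" using C(4) U(4) assms(3-5) by blast
    then show ?thesis using orthogonal_restriction[OF orth[OF C(3) U(3)]] C(1) U(1) by blast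
  qed
  ultimately have "orthogonally_oriented_matroid N \<C>\<^sub>N \<D>\<^sub>N"
    using N unfolding orthogonally_oriented_matroid_def by blast
  then show ?thesis using ground unfolding orthogonally_orientable_def by blast
qed

end
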